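(* (A modified Schur–Frobenius factorization.) Let $\mathcal M\in\mathcal L(\mathcal X)$, let $U,V\subset S$ with $U\neq\emptyset$ and $U\cap V=\emptyset$, and let $\lambda,\eta\in\mathbb C$ with $\lambda\ne0$ and $\eta\neq0$. Assume that $\lambda$ is in the resolvent set of $\mathcal M_{VV}$. Put $W=U\cup V$. Then the operator $$\mathcal M_\eta:=\begin{pmatrix}\mathcal M_{UU}&\eta\lambda^{-1}\mathcal M_{UV}\\ \mathcal M_{VU}&\eta\lambda^{-1}\mathcal M_{VV}\end{pmatrix}$$ satisfies $$\mathcal M_\eta-\eta\mathcal I=\begin{pmatrix}\mathcal I&\mathcal M_{UV}\mathcal R_\lambda\\ \mathcal O&\mathcal I\end{pmatrix}\begin{pmatrix}\mathcal M[U,V,\lambda]-\eta\mathcal I&\mathcal O\\ \mathcal O&\eta\lambda^{-1}(\mathcal M_{VV}-\lambda\mathcal I)\end{pmatrix}\begin{pmatrix}\mathcal I&\mathcal O\\ \lambda\eta^{-1}\mathcal R_\lambda\mathcal M_{VU}&\mathcal I\end{pmatrix},$$ where $\mathcal R_\lambda=(\mathcal M_{VV}-\lambda\mathcal I)^{-1}$. Consequently, $\eta$ is in the resolvent set of $\mathcal M_\eta$ if and only if $\eta$ is in the resolvent set of $\mathcal M[U,V,\lambda]$.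
   Context: $S$ is a countable set, $A$ a zero-one matrix indexed by $S\times S$, and $X=\{\omega\in\prod_{n\ge0}S:A(\omega_n\omega_{n+1})=1\ \forall n\}$. For $U\subset S$, $\Sigma_U=\{\omega\in X:\omega_0\in U\}$ and $\chi_U$ is its indicator function. $(\mathcal X,\|\cdot\|)$ is a complex Banach space of functions on $X$ such that $f\chi_U\in\mathcal X$ for all $f\in\mathcal X$, $U\subset S$, with $f\mapsto f\chi_U$ bounded. $\mathcal L(\mathcal X)$ is the set of bounded linear operators on $\mathcal X$. For $\mathcal M\in\mathcal L(\mathcal X)$ and $U_1,U_2\subset S$, $\mathcal M_{U_1U_2}f=\chi_{U_1}\mathcal M(\chi_{U_2}f)$. $\mathcal I$ is the identity, $\mathcal O$ the zero operator. For disjoint $U,V$ and $W=U\cup V$, a $2\times2$ block operator matrix with blocks $\mathcal N_{UU},\mathcal N_{UV},\mathcal N_{VU},\mathcal N_{VV}$ denotes the operator $\mathcal N_{UU}+\mathcal N_{UV}+\mathcal N_{VU}+\mathcal N_{VV}$; in such block equations $\mathcal I$ stands for the identity restricted to the relevant block (so the factorization is an identity of operators on $\chi_W\mathcal X=\chi_U\mathcal X\oplus\chi_V\mathcal X$). For $\lambda$ in the resolvent set of $\mathcal M_{VV}$ (as an operator on $\mathcal X$), the bounded operator $\mathcal M[U,V,\lambda]:\mathcal X\to\mathcal X$ is $$\mathcal M[U,V,\lambda]=\mathcal M_{UU}+\mathcal M_{UV}(\lambda\mathcal I-\mathcal M_{VV})^{-1}\mathcal M_{VU}.$$ *)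

theory Defs
  imports "HOL-Analysis.Analysis" "HOL-Library.Function_Algebras"
begin

text \<open>
  A complex function on a set \<open>X\<close> is encoded as a total function vanishing outside \<open>X\<close>. Operators are
  HOL functions on functions; only their values on the carrier \<open>F\<close> are meaningful, so identities
  between operators are stated pointwise on a carrier. Sum, difference and zero of functions and of
  operators are the pointwise ones of \<^theory>\<open>HOL-Library.Function_Algebras\<close>; the product of
  operators is \<open>\<circ>\<close> and the identity operator is \<^const>\<open>id\<close>.
\<close>

type_synonym 'p func = "'p \<Rightarrow> complex"
type_synonym 'p oper = "'p func \<Rightarrow> 'p func"

definition fscale :: "complex \<Rightarrow> 'p func \<Rightarrow> 'p func" where
  "fscale c f = (\<lambda>x. c * f x)"

definition oscale :: "complex \<Rightarrow> 'p oper \<Rightarrow> 'p oper"  (infixr "*\<^sub>o" 75) where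
  "c *\<^sub>o T = (\<lambda>f. fscale c (T f))"

definition bounded_op :: "'p func set \<Rightarrow> ('p func \<Rightarrow> real) \<Rightarrow> 'p oper \<Rightarrow> bool" where
  "bounded_op F nrm T \<longleftrightarrow>
     (\<forall>f\<in>F. T f \<in> F) \<and>
     (\<forall>f\<in>F. \<forall>g\<in>F. T (f + g) = T f + T g) \<and>
     (\<forall>c. \<forall>f\<in>F. T (fscale c f) = fscale c (T f)) \<and>
     (\<exists>K. \<forall>f\<in>F. nrm (T f) \<le> K * nrm f)"

definition resolvent_set :: "'p func set \<Rightarrow> ('p func \<Rightarrow> real) \<Rightarrow> 'p oper \<Rightarrow> complex set" where
  "resolvent_set F nrm T =
     {z. \<exists>R. bounded_op F nrm R \<and>
          (\<forall>f\<in>F. R ((z *\<^sub>o id - T) f) = f \<and> (z *\<^sub>o id - T) (R f) = f)}"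

locale function_banach_space =
  fixes X :: "'p set" and F :: "'p func set" and nrm :: "'p func \<Rightarrow> real"
  assumes outside: "\<And>f x. f \<in> F \<Longrightarrow> x \<notin> X \<Longrightarrow> f x = 0"
    and zero_mem: "0 \<in> F"
    and add_mem: "\<And>f g. f \<in> F \<Longrightarrow> g \<in> F \<Longrightarrow> f + g \<in> F"
    and scale_mem: "\<And>c f. f \<in> F \<Longrightarrow> fscale c f \<in> F"
    and nrm_nonneg: "\<And>f. f \<in> F \<Longrightarrow> 0 \<le> nrm f"
    and nrm_eq_0: "\<And>f. f \<in> F \<Longrightarrow> nrm f = 0 \<Longrightarrow> f = 0"
    and nrm_triangle: "\<And>f g. f \<in> F \<Longrightarrow> g \<in> F \<Longrightarrow> nrm (f + g) \<le> nrm f + nrm g"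
    and nrm_scale: "\<And>c f. f \<in> F \<Longrightarrow> nrm (fscale c f) = cmod c * nrm f"
    and complete: "\<And>s :: nat \<Rightarrow> 'p func. (\<And>n. s n \<in> F) \<Longrightarrow>
          (\<And>e. e > 0 \<Longrightarrow> \<exists>M. \<forall>m\<ge>M. \<forall>n\<ge>M. nrm (s m - s n) < e) \<Longrightarrow>
          \<exists>f\<in>F. (\<lambda>n. nrm (s n - f)) \<longlonglongrightarrow> 0"

definition shift_space :: "'s set \<Rightarrow> ('s \<Rightarrow> 's \<Rightarrow> nat) \<Rightarrow> (nat \<Rightarrow> 's) set" where
  "shift_space S A = {\<omega>. (\<forall>n. \<omega> n \<in> S) \<and> (\<forall>n. A (\<omega> n) (\<omega> (Suc n)) = 1)}"

definition cyl :: "'s set \<Rightarrow> ('s \<Rightarrow> 's \<Rightarrow> nat) \<Rightarrow> 's set \<Rightarrow> (nat \<Rightarrow> 's) set" where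
  "cyl S A U = {\<omega> \<in> shift_space S A. \<omega> 0 \<in> U}"

text \<open>Multiplication by the indicator function of \<^term>\<open>cyl S A U\<close>, as an operator.\<close>

definition chi :: "'s set \<Rightarrow> ('s \<Rightarrow> 's \<Rightarrow> nat) \<Rightarrow> 's set \<Rightarrow> (nat \<Rightarrow> 's) oper" where
  "chi S A U f = (\<lambda>\<omega>. indicator (cyl S A U) \<omega> * f \<omega>)"

locale shift_banach_space =
  function_banach_space "shift_space S A" F nrm
  for S :: "'s set" and A :: "'s \<Rightarrow> 's \<Rightarrow> nat"
    and F :: "(nat \<Rightarrow> 's) func set" and nrm :: "(nat \<Rightarrow> 's) func \<Rightarrow> real" +
  assumes countable_S: "countable S"
    and zero_one: "\<And>i j. i \<in> S \<Longrightarrow> j \<in> S \<Longrightarrow> A i j \<in> {0, 1}"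
    and chi_bounded: "\<And>U. U \<subseteq> S \<Longrightarrow> bounded_op F nrm (chi S A U)"

text \<open>The compression \<open>M\<^bsub>U1 U2\<^esub>\<close>.\<close>

definition compr :: "'s set \<Rightarrow> ('s \<Rightarrow> 's \<Rightarrow> nat) \<Rightarrow> 's set \<Rightarrow> 's set \<Rightarrow>
    (nat \<Rightarrow> 's) oper \<Rightarrow> (nat \<Rightarrow> 's) oper" where
  "compr S A U1 U2 M = chi S A U1 \<circ> M \<circ> chi S A U2"

text \<open>
  The operator denoted by the block matrix with rows \<open>(N11, N12)\<close> and \<open>(N21, N22)\<close> with respect to
  \<open>(U, V)\<close>. Compressing every entry to its block leaves entries that already live on their block
  unchanged and turns an entry \<^const>\<open>id\<close> into the identity restricted to that block.
\<close>

definition block_op :: "'s set \<Rightarrow> ('s \<Rightarrow> 's \<Rightarrow> nat) \<Rightarrow> 's set \<Rightarrow> 's set \<Rightarrow>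
    (nat \<Rightarrow> 's) oper \<Rightarrow> (nat \<Rightarrow> 's) oper \<Rightarrow> (nat \<Rightarrow> 's) oper \<Rightarrow> (nat \<Rightarrow> 's) oper \<Rightarrow>
    (nat \<Rightarrow> 's) oper" where
  "block_op S A U V N11 N12 N21 N22 =
     compr S A U U N11 + compr S A U V N12 + compr S A V U N21 + compr S A V V N22"

text \<open>
  \<open>M[U,V,z]\<close>. For \<open>z\<close> in the resolvent set of \<open>M\<^bsub>VV\<^esub>\<close> the operator \<open>z I - M\<^bsub>VV\<^esub>\<close> is a bijection of
  \<open>F\<close>, and \<^const>\<open>inv_into\<close> is its inverse there.
\<close>

definition schur_op :: "'s set \<Rightarrow> ('s \<Rightarrow> 's \<Rightarrow> nat) \<Rightarrow> (nat \<Rightarrow> 's) func set \<Rightarrow>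
    (nat \<Rightarrow> 's) oper \<Rightarrow> 's set \<Rightarrow> 's set \<Rightarrow> complex \<Rightarrow> (nat \<Rightarrow> 's) oper" where
  "schur_op S A F M U V z =
     compr S A U U M
     + (compr S A U V M \<circ> inv_into F (z *\<^sub>o id - compr S A V V M) \<circ> compr S A V U M)"

end

theory Submission
  imports Defs
begin

text \<open>
  With \<open>R0 = (\<lambda> I - M\<^bsub>VV\<^esub>)\<^sup>-\<^sup>1\<close> and \<open>L = M[U,V,\<lambda>]\<close>, the block factorization extends to all of \<open>F\<close> as
  \<open>\<eta> I - M\<^bsub>\<eta>\<^esub> = (I - M\<^bsub>UV\<^esub> R0) (\<eta> I - L - (\<eta>/\<lambda>) M\<^bsub>VV\<^esub>) (I - (\<lambda>/\<eta>) R0 M\<^bsub>VU\<^esub>)\<close>. The outer factors are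
  unipotent, and since \<open>L M\<^bsub>VV\<^esub> = 0\<close> the middle one equals \<open>(\<eta> I - L) (I - \<lambda>\<^sup>-\<^sup>1 M\<^bsub>VV\<^esub>)\<close>, whose second
  factor is invertible. So \<open>\<eta> I - M\<^bsub>\<eta>\<^esub>\<close> and \<open>\<eta> I - L\<close> are invertible together.
\<close>

section \<open>Scalar multiples and invertibility on a carrier set\<close>

lemma fscale_simps [simp]:
  "fscale c (f + g) = fscale c f + fscale c g"
  "fscale c (f - g) = fscale c f - fscale c g"
  "fscale c (- f) = - fscale c f"
  "fscale c 0 = 0"
  "fscale 0 f = 0"
  "fscale 1 f = f"
  "fscale c (fscale d f) = fscale (c * d) f"
  by (auto simp: fscale_def fun_eq_iff algebra_simps)

lemma fscale_minus_one: "fscale (- 1) f = - f"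
  by (auto simp: fscale_def fun_eq_iff)

definition invertible_op :: "'p func set \<Rightarrow> ('p func \<Rightarrow> real) \<Rightarrow> 'p oper \<Rightarrow> bool" where
  "invertible_op F nrm T \<longleftrightarrow>
     (\<exists>R. bounded_op F nrm R \<and> (\<forall>f\<in>F. R (T f) = f \<and> T (R f) = f))"

lemma resolvent_set_iff: "z \<in> resolvent_set F nrm T \<longleftrightarrow> invertible_op F nrm (z *\<^sub>o id - T)"
  by (simp add: resolvent_set_def invertible_op_def)

lemma resolvent_setI:
  assumes "bounded_op F nrm R" "\<And>f. f \<in> F \<Longrightarrow> R (fscale z f - T f) = f"
    "\<And>f. f \<in> F \<Longrightarrow> fscale z (R f) - T (R f) = f"
  shows "z \<in> resolvent_set F nrm T"
  using assms by (auto simp: resolvent_set_def oscale_def)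

lemma resolvent_setD:
  assumes "z \<in> resolvent_set F nrm T"
  shows "\<exists>R. bounded_op F nrm R \<and>
    (\<forall>f\<in>F. R (fscale z f - T f) = f \<and> fscale z (R f) - T (R f) = f)"
  using assms by (simp add: resolvent_set_def oscale_def)

text \<open>Operators carry meaning only on \<open>F\<close>. A bounded candidate inverse maps
  \<open>F\<close> into \<open>F\<close>, so both composites evaluate \<open>S\<close> and
  \<open>T\<close> at points of \<open>F\<close> only.\<close>

lemma invertible_op_cong:
  assumes "\<And>f. f \<in> F \<Longrightarrow> S f = T f"
  shows "invertible_op F nrm S \<longleftrightarrow> invertible_op F nrm T"
proof -
  have "(\<forall>f\<in>F. R (S f) = f \<and> S (R f) = f) \<longleftrightarrow> (\<forall>f\<in>F. R (T f) = f \<and> T (R f) = f)"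
    if "bounded_op F nrm R" for R
    using assms that by (simp add: bounded_op_def)
  then show ?thesis unfolding invertible_op_def by blast
qed

lemma bounded_op_mem: "bounded_op F nrm T \<Longrightarrow> f \<in> F \<Longrightarrow> T f \<in> F"
  and bounded_op_add: "bounded_op F nrm T \<Longrightarrow> f \<in> F \<Longrightarrow> g \<in> F \<Longrightarrow> T (f + g) = T f + T g"
  and bounded_op_scale: "bounded_op F nrm T \<Longrightarrow> f \<in> F \<Longrightarrow> T (fscale c f) = fscale c (T f)"
  by (auto simp: bounded_op_def)

lemma bounded_op_subset:
  assumes "bounded_op F nrm T" "G \<subseteq> F" "\<And>f. f \<in> G \<Longrightarrow> T f \<in> G"
  shows "bounded_op G nrm T"
proof -
  obtain K where "\<forall>f\<in>F. nrm (T f) \<le> K * nrm f"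
    using assms(1) by (auto simp: bounded_op_def)
  then have "\<forall>f\<in>G. nrm (T f) \<le> K * nrm f" using assms(2) by blast
  moreover have "T (f + g) = T f + T g" "T (fscale c f) = fscale c (T f)"
    if "f \<in> G" "g \<in> G" for f g c
    using that assms bounded_op_add[OF assms(1)] bounded_op_scale[OF assms(1)] by blast+
  ultimately show ?thesis using assms(3) unfolding bounded_op_def by blast
qed

section \<open>Algebra of bounded and invertible operators on \<open>F\<close>\<close>

context function_banach_space
begin

lemma uminus_mem: "f \<in> F \<Longrightarrow> - f \<in> F"
  using scale_mem[of f "-1"] by (simp add: fscale_minus_one)

lemma diff_mem: "f \<in> F \<Longrightarrow> g \<in> F \<Longrightarrow> f - g \<in> F"
  using add_mem[of f "- g"] uminus_mem by simp

lemma bounded_op_uminus: "bounded_op F nrm T \<Longrightarrow> f \<in> F \<Longrightarrow> T (- f) = - T f"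
  using bounded_op_scale[of F nrm T f "-1"] by (simp add: fscale_minus_one)

lemma bounded_op_diff:
  assumes "bounded_op F nrm T" "f \<in> F" "g \<in> F"
  shows "T (f - g) = T f - T g"
  using bounded_op_add[OF assms(1,2) uminus_mem[OF assms(3)]] bounded_op_uminus[OF assms(1,3)]
  by (simp only: diff_conv_add_uminus)

lemma bounded_op_zero: "bounded_op F nrm T \<Longrightarrow> T 0 = 0"
  using bounded_op_scale[of F nrm T 0 0] zero_mem by simp

text \<open>The constant in \<open>bounded_op\<close> may have any sign; passing to its absolute
  value gives one by which inequalities can be multiplied, as composition requires.\<close>

lemma bounded_op_bound:
  assumes "bounded_op F nrm T"
  obtains K where "K \<ge> 0" "\<And>f. f \<in> F \<Longrightarrow> nrm (T f) \<le> K * nrm f"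
proof -
  obtain K where K: "\<And>f. f \<in> F \<Longrightarrow> nrm (T f) \<le> K * nrm f"
    using assms unfolding bounded_op_def by blast
  have "nrm (T f) \<le> \<bar>K\<bar> * nrm f" if "f \<in> F" for f
    using K[OF that] nrm_nonneg[OF that] mult_right_mono[of K "\<bar>K\<bar>" "nrm f"] by linarith
  then show ?thesis using that[of "\<bar>K\<bar>"] by simp
qed

lemma bounded_op_id [intro]: "bounded_op F nrm id"
  by (auto simp: bounded_op_def intro: exI[of _ 1])

lemma bounded_op_plus [intro]:
  assumes "bounded_op F nrm S" "bounded_op F nrm T"
  shows "bounded_op F nrm (S + T)"
proof -
  obtain K where K: "\<And>f. f \<in> F \<Longrightarrow> nrm (S f) \<le> K * nrm f"
    using bounded_op_bound[OF assms(1)] by blast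
  obtain L where L: "\<And>f. f \<in> F \<Longrightarrow> nrm (T f) \<le> L * nrm f"
    using bounded_op_bound[OF assms(2)] by blast
  have "nrm (S f + T f) \<le> (K + L) * nrm f" if "f \<in> F" for f
    using nrm_triangle[of "S f" "T f"] K[OF that] L[OF that] assms that
    by (simp add: bounded_op_mem algebra_simps)
  then show ?thesis
    using assms unfolding bounded_op_def
    by (auto simp: add_mem intro: exI[of _ "K + L"])
qed

lemma bounded_op_oscale [intro]:
  assumes "bounded_op F nrm T"
  shows "bounded_op F nrm (c *\<^sub>o T)"
proof -
  obtain K where K: "\<And>f. f \<in> F \<Longrightarrow> nrm (T f) \<le> K * nrm f"
    using bounded_op_bound[OF assms(1)] by blast
  have "nrm (fscale c (T f)) \<le> (cmod c * K) * nrm f" if "f \<in> F" for f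
    using nrm_scale[of "T f" c] mult_left_mono[OF K[OF that], of "cmod c"] assms that
    by (simp add: bounded_op_mem algebra_simps)
  then show ?thesis
    using assms unfolding bounded_op_def oscale_def
    by (auto simp: scale_mem mult.commute intro: exI[of _ "cmod c * K"])
qed

lemma bounded_op_minus [intro]:
  assumes "bounded_op F nrm S" "bounded_op F nrm T"
  shows "bounded_op F nrm (S - T)"
proof -
  have eq: "S - T = S + (-1) *\<^sub>o T"
    by (simp add: fun_eq_iff oscale_def fscale_minus_one)
  show ?thesis unfolding eq using assms by blast
qed

lemma bounded_op_comp [intro]:
  assumes "bounded_op F nrm S" "bounded_op F nrm T"
  shows "bounded_op F nrm (S \<circ> T)"
proof -
  obtain K where K: "K \<ge> 0" "\<And>f. f \<in> F \<Longrightarrow> nrm (S f) \<le> K * nrm f"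
    using bounded_op_bound[OF assms(1)] by blast
  obtain L where L: "\<And>f. f \<in> F \<Longrightarrow> nrm (T f) \<le> L * nrm f"
    using bounded_op_bound[OF assms(2)] by blast
  have "nrm (S (T f)) \<le> (K * L) * nrm f" if "f \<in> F" for f
    using K(2)[of "T f"] mult_left_mono[OF L[OF that] K(1)] assms(2) that
    by (simp add: bounded_op_mem algebra_simps)
  then show ?thesis
    using assms unfolding bounded_op_def by (auto intro: exI[of _ "K * L"])
qed

lemma invertible_op_comp:
  assumes "invertible_op F nrm S" "invertible_op F nrm T"
    "bounded_op F nrm T"
  shows "invertible_op F nrm (S \<circ> T)"
proof -
  obtain S' where "bounded_op F nrm S'" "\<And>f. f \<in> F \<Longrightarrow> S' (S f) = f \<and> S (S' f) = f"
    using assms(1) by (auto simp: invertible_op_def)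
  moreover obtain T' where "bounded_op F nrm T'" "\<And>f. f \<in> F \<Longrightarrow> T' (T f) = f \<and> T (T' f) = f"
    using assms(2) by (auto simp: invertible_op_def)
  ultimately show ?thesis
    using assms(3) unfolding invertible_op_def
    by (intro exI[of _ "T' \<circ> S'"]) (auto simp: bounded_op_mem)
qed

text \<open>The converse multiplies by the two inverses:
  \<open>N' \<circ> (N \<circ> T \<circ> P) \<circ> P'\<close> is a composite of invertible
  operators and agrees with \<open>T\<close> on \<open>F\<close>.\<close>

lemma invertible_op_sandwich:
  assumes N: "invertible_op F nrm N" "bounded_op F nrm N"
    and P: "invertible_op F nrm P" "bounded_op F nrm P"
    and T: "bounded_op F nrm T"
  shows "invertible_op F nrm (N \<circ> T \<circ> P) \<longleftrightarrow> invertible_op F nrm T"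
proof
  assume "invertible_op F nrm T"
  then show "invertible_op F nrm (N \<circ> T \<circ> P)"
    using assms by (intro invertible_op_comp) auto
next
  assume inv: "invertible_op F nrm (N \<circ> T \<circ> P)"
  obtain N' where N': "bounded_op F nrm N'" "\<And>f. f \<in> F \<Longrightarrow> N' (N f) = f \<and> N (N' f) = f"
    using N by (auto simp: invertible_op_def)
  obtain P' where P': "bounded_op F nrm P'" "\<And>f. f \<in> F \<Longrightarrow> P' (P f) = f \<and> P (P' f) = f"
    using P by (auto simp: invertible_op_def)
  have "invertible_op F nrm N'" "invertible_op F nrm P'"
    using N N' P P' by (auto simp: invertible_op_def)
  then have "invertible_op F nrm (N' \<circ> (N \<circ> T \<circ> P) \<circ> P')"
    using invertible_op_comp[OF invertible_op_comp[OF _ inv] _ P'(1)] assms N'(1) by blast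
  moreover have "(N' \<circ> (N \<circ> T \<circ> P) \<circ> P') f = T f" if "f \<in> F" for f
    using that N' P' T by (simp add: bounded_op_mem)
  ultimately show "invertible_op F nrm T"
    using invertible_op_cong[of F "N' \<circ> (N \<circ> T \<circ> P) \<circ> P'" T] by blast
qed

lemma invertible_op_oscale:
  assumes "invertible_op F nrm T" "bounded_op F nrm T" "c \<noteq> 0"
  shows "invertible_op F nrm (c *\<^sub>o T)"
proof -
  obtain R where R: "bounded_op F nrm R" "\<And>f. f \<in> F \<Longrightarrow> R (T f) = f \<and> T (R f) = f"
    using assms(1) by (auto simp: invertible_op_def)
  have "bounded_op F nrm ((1 / c) *\<^sub>o R)" using R by blast
  moreover have "((1 / c) *\<^sub>o R) ((c *\<^sub>o T) f) = f \<and> (c *\<^sub>o T) (((1 / c) *\<^sub>o R) f) = f"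
    if "f \<in> F" for f
    using that R assms(3) bounded_op_mem[OF R(1)] bounded_op_mem[OF assms(2)]
    by (simp add: oscale_def bounded_op_scale[OF R(1)] bounded_op_scale[OF assms(2)])
  ultimately show ?thesis unfolding invertible_op_def by blast
qed

text \<open>Since \<open>N\<close> squares to zero, the Neumann series of the inverse stops after
  two terms, leaving \<open>id - N\<close>.\<close>

lemma invertible_op_unipotent:
  assumes "bounded_op F nrm N" "\<And>f. f \<in> F \<Longrightarrow> N (N f) = 0"
  shows "invertible_op F nrm (id + N)"
proof -
  have "bounded_op F nrm (id - N)" using assms(1) by blast
  moreover have "(id - N) ((id + N) f) = f \<and> (id + N) ((id - N) f) = f" if "f \<in> F" for f
    using that assms(2) bounded_op_mem[OF assms(1)]
    by (simp add: bounded_op_add[OF assms(1)] bounded_op_diff[OF assms(1)])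
  ultimately show ?thesis unfolding invertible_op_def by blast
qed

text \<open>An operator supported on the range of a projection \<open>p\<close> acts as zero on the complement, so
  \<open>z \<noteq> 0\<close> only has to be tested on the range.\<close>

lemma resolvent_set_corner:
  assumes p: "bounded_op F nrm p" "\<And>f. f \<in> F \<Longrightarrow> p (p f) = p f"
    and T: "bounded_op F nrm T"
      "\<And>f. f \<in> F \<Longrightarrow> p (T f) = T f" "\<And>f. f \<in> F \<Longrightarrow> T (p f) = T f"
    and z: "z \<noteq> 0"
  shows "z \<in> resolvent_set (p ` F) nrm T \<longleftrightarrow> z \<in> resolvent_set F nrm T"
proof -
  have sub: "p ` F \<subseteq> F" using bounded_op_mem[OF p(1)] by blast
  have fix_p: "p f = f" if "f \<in> p ` F" for f using that p(2) by blast
  note lin = bounded_op_mem[OF p(1)] bounded_op_add[OF p(1)] bounded_op_scale[OF p(1)]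
    bounded_op_diff[OF p(1)] bounded_op_mem[OF T(1)] bounded_op_add[OF T(1)]
    bounded_op_scale[OF T(1)] bounded_op_diff[OF T(1)]
  show ?thesis
  proof
    assume "z \<in> resolvent_set F nrm T"
    from resolvent_setD[OF this] obtain R where R: "bounded_op F nrm R"
      and RR: "\<forall>f\<in>F. R (fscale z f - T f) = f \<and> fscale z (R f) - T (R f) = f"
      by (elim exE conjE)
    have RT: "R (fscale z f - T f) = f" and TR: "fscale z (R f) - T (R f) = f" if "f \<in> F" for f
      using bspec[OF RR that] by simp_all
    \<comment> \<open>\<open>T\<close> commutes with \<open>p\<close>, so for \<open>f\<close> in
      the range both \<open>R f\<close> and \<open>p (R f)\<close> solve the same resolvent
      equation; uniqueness makes them equal, hence \<open>R\<close> preserves the range.\<close>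
    have inv: "R f \<in> p ` F" if "f \<in> p ` F" for f
    proof -
      have f: "f \<in> F" "p f = f" using that sub fix_p by blast+
      then have Rf: "R f \<in> F" "p (R f) \<in> F" using bounded_op_mem[OF R] by (auto simp: lin)
      have "fscale z (p (R f)) - T (p (R f)) = p (fscale z (R f) - T (R f))"
        using Rf by (simp add: lin T(2,3) scale_mem)
      also have "\<dots> = f" using TR f by simp
      finally have "R f = p (R f)" using RT[OF Rf(2)] by simp
      then show ?thesis using Rf(1) by (rule image_eqI)
    qed
    have "bounded_op (p ` F) nrm R"
      using R sub inv by (rule bounded_op_subset)
    moreover have "R (fscale z f - T f) = f" "fscale z (R f) - T (R f) = f" if "f \<in> p ` F" for f
      using RT TR subsetD[OF sub that] by simp_all
    ultimately show "z \<in> resolvent_set (p ` F) nrm T"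
      by (rule resolvent_setI)
  next
    assume "z \<in> resolvent_set (p ` F) nrm T"
    from resolvent_setD[OF this] obtain R where R: "bounded_op (p ` F) nrm R"
      and RR: "\<forall>f\<in>p ` F. R (fscale z f - T f) = f \<and> fscale z (R f) - T (R f) = f"
      by (elim exE conjE)
    have RT: "R (fscale z f - T f) = f" and TR: "fscale z (R f) - T (R f) = f" if "f \<in> p ` F" for f
      using bspec[OF RR that] by simp_all
    have R_mem: "R (p f) \<in> F" if "f \<in> F" for f
      using subsetD[OF sub bounded_op_mem[OF R]] that by simp
    have Rp: "bounded_op F nrm (R \<circ> p)"
    proof -
      \<comment> \<open>The bound for \<open>R\<close> holds on the range only; it is combined with
        the bound for \<open>p\<close>, with the absolute value of \<open>K\<close> keeping the
        product monotone.\<close>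
      have "\<exists>K. \<forall>f\<in>p ` F. nrm (R f) \<le> K * nrm f"
        using R unfolding bounded_op_def by (elim conjE)
      then obtain K where K: "\<forall>f\<in>p ` F. nrm (R f) \<le> K * nrm f" by (elim exE)
      obtain L where L: "\<And>f. f \<in> F \<Longrightarrow> nrm (p f) \<le> L * nrm f"
        using bounded_op_bound[OF p(1)] by blast
      have "nrm (R (p f)) \<le> (\<bar>K\<bar> * L) * nrm f" if "f \<in> F" for f
      proof -
        have "nrm (R (p f)) \<le> K * nrm (p f)" using bspec[OF K] that by simp
        also have "\<dots> \<le> \<bar>K\<bar> * nrm (p f)"
          using nrm_nonneg[OF lin(1)[OF that]] by (intro mult_right_mono) auto
        also have "\<dots> \<le> \<bar>K\<bar> * (L * nrm f)" using L that by (intro mult_left_mono) auto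
        finally show ?thesis by (simp add: algebra_simps)
      qed
      moreover have "R (p (f + g)) = R (p f) + R (p g)" if "f \<in> F" "g \<in> F" for f g
        using bounded_op_add[OF R, of "p f" "p g"] that by (simp add: lin)
      moreover have "R (p (fscale c f)) = fscale c (R (p f))" if "f \<in> F" for c f
        using bounded_op_scale[OF R, of "p f"] that by (simp add: lin)
      ultimately show ?thesis
        using R_mem by (auto simp: bounded_op_def)
    qed
    \<comment> \<open>On the range of \<open>p\<close> the given inverse is used. On the
      complementary range \<open>T\<close> is zero, so \<open>z I - T\<close> is multiplication by
      \<open>z\<close> there and is inverted by \<open>1 / z\<close>.\<close>
    define Q where "Q = (R \<circ> p) + (1 / z) *\<^sub>o (id - p)"
    have "bounded_op F nrm Q" unfolding Q_def using Rp p(1) by auto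
    moreover have "Q (fscale z f - T f) = f" if f: "f \<in> F" for f
    proof -
      have "R (p (fscale z f - T f)) = R (fscale z (p f) - T (p f))"
        using f by (simp add: lin T(2,3) scale_mem)
      then have "R (p (fscale z f - T f)) = p f" using RT f by simp
      then show ?thesis
        using f z by (simp add: Q_def oscale_def lin T(2,3) scale_mem algebra_simps)
    qed
    moreover have "fscale z (Q f) - T (Q f) = f" if f: "f \<in> F" for f
    proof -
      have "fscale z (R (p f)) - T (R (p f)) = p f" using TR f by simp
      then show ?thesis
        using f z R_mem[OF f]
        by (simp add: Q_def oscale_def lin T(3) scale_mem add_mem diff_mem algebra_simps)
    qed
    ultimately show "z \<in> resolvent_set F nrm T"
      by (rule resolvent_setI)
  qed
qed

end

section \<open>Multiplication by cylinder indicators\<close>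

lemma chi_simps:
  "chi S A U (f + g) = chi S A U f + chi S A U g"
  "chi S A U (f - g) = chi S A U f - chi S A U g"
  "chi S A U (fscale c f) = fscale c (chi S A U f)"
  "chi S A U (- f) = - chi S A U f"
  "chi S A U 0 = 0"
  "chi S A U (chi S A U f) = chi S A U f"
  by (auto simp: chi_def fscale_def fun_eq_iff algebra_simps indicator_def)

lemma chi_disjoint: "U \<inter> V = {} \<Longrightarrow> chi S A U (chi S A V f) = 0"
  by (auto simp: chi_def fun_eq_iff indicator_def cyl_def)

lemma chi_Un: "U \<inter> V = {} \<Longrightarrow> chi S A (U \<union> V) f = chi S A U f + chi S A V f"
  by (auto simp: chi_def fun_eq_iff indicator_def cyl_def)

theorem theorem2p6:
  fixes S :: "'s set" and A :: "'s \<Rightarrow> 's \<Rightarrow> nat"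
    and F :: "((nat \<Rightarrow> 's) \<Rightarrow> complex) set" and nrm :: "((nat \<Rightarrow> 's) \<Rightarrow> complex) \<Rightarrow> real"
    and M :: "((nat \<Rightarrow> 's) \<Rightarrow> complex) \<Rightarrow> ((nat \<Rightarrow> 's) \<Rightarrow> complex)"
    and R M_eta :: "((nat \<Rightarrow> 's) \<Rightarrow> complex) \<Rightarrow> ((nat \<Rightarrow> 's) \<Rightarrow> complex)"
    and U V W :: "'s set" and lam \<eta> :: complex
  assumes "shift_banach_space S A F nrm"
    and "bounded_op F nrm M"
    and "U \<subseteq> S" and "V \<subseteq> S" and "U \<noteq> {}" and "U \<inter> V = {}"
    and "lam \<noteq> 0" and "\<eta> \<noteq> 0"
    and "lam \<in> resolvent_set F nrm (compr S A V V M)"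
    and "W = U \<union> V"
    and "R = inv_into F (compr S A V V M - lam *\<^sub>o id)"
    and "M_eta = block_op S A U V
                 (compr S A U U M) ((\<eta> / lam) *\<^sub>o compr S A U V M)
                 (compr S A V U M) ((\<eta> / lam) *\<^sub>o compr S A V V M)"
  shows "(\<forall>f \<in> chi S A W ` F.
            (M_eta - \<eta> *\<^sub>o id) f =
            (block_op S A U V
               id (compr S A U V M \<circ> R)
               0  id
             \<circ> block_op S A U V
               (schur_op S A F M U V lam - \<eta> *\<^sub>o id) 0
               0 ((\<eta> / lam) *\<^sub>o (compr S A V V M - lam *\<^sub>o id))
             \<circ> block_op S A U V
               id 0
               ((lam / \<eta>) *\<^sub>o (R \<circ> compr S A V U M)) id) f)
       \<and> (\<eta> \<in> resolvent_set F nrm M_eta \<longleftrightarrow> \<eta> \<in> resolvent_set F nrm (schur_op S A F M U V lam))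
       \<and> (\<eta> \<in> resolvent_set (chi S A W ` F) nrm M_eta \<longleftrightarrow>
            \<eta> \<in> resolvent_set F nrm (schur_op S A F M U V lam))"
proof -
  interpret shift_banach_space S A F nrm by fact
  note M = assms(2) and disj = assms(6) and lam = assms(7) and eta = assms(8)

  \<comment> \<open>Block relations for the four corners of \<open>M\<close>\<close>
  define p q where "p = chi S A U" and "q = chi S A V"
  define a b c d where "a = compr S A U U M" and "b = compr S A U V M"
    and "c = compr S A V U M" and "d = compr S A V V M"
  note abcd = a_def b_def c_def d_def
  define L where "L = schur_op S A F M U V lam"
  define k where "k = \<eta> / lam"
  have pq: "bounded_op F nrm p" "bounded_op F nrm q"
    unfolding p_def q_def using assms chi_bounded by auto
  have bop: "bounded_op F nrm a" "bounded_op F nrm b" "bounded_op F nrm c" "bounded_op F nrm d"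
    unfolding abcd compr_def using pq M by (auto simp: p_def q_def)
  have VU: "V \<inter> U = {}" using disj by auto
  have lin_pq: "p (f + g) = p f + p g" "q (f + g) = q f + q g"
    "p (f - g) = p f - p g" "q (f - g) = q f - q g" "p (- f) = - p f" "q (- f) = - q f"
    "p (fscale z f) = fscale z (p f)" "q (fscale z f) = fscale z (q f)" "p 0 = 0" "q 0 = 0"
    "p (p f) = p f" "q (q f) = q f" "p (q f) = 0" "q (p f) = 0" for f g z
    unfolding p_def q_def by (simp_all add: chi_simps chi_disjoint[OF disj] chi_disjoint[OF VU])
  have abcd_eq: "a f = p (M (p f))" "b f = p (M (q f))" "c f = q (M (p f))" "d f = q (M (q f))" for f
    by (simp_all add: abcd compr_def p_def q_def)
  \<comment> \<open>The vanishing products below, such as \<open>a (q f)\<close>, reduce to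
    \<open>p (M 0)\<close>. They hold for every function, in \<open>F\<close> or not, because
    \<open>p\<close> and \<open>q\<close> multiply pointwise.\<close>
  have M0: "M 0 = 0" using M by (rule bounded_op_zero)
  have corner: "p (a f) = a f" "a (p f) = a f" "q (a f) = 0" "a (q f) = 0"
    "p (b f) = b f" "b (q f) = b f" "q (b f) = 0" "b (p f) = 0"
    "q (c f) = c f" "c (p f) = c f" "p (c f) = 0" "c (q f) = 0"
    "q (d f) = d f" "d (q f) = d f" "p (d f) = 0" "d (p f) = 0" for f
    by (simp_all add: abcd_eq lin_pq M0)

  \<comment> \<open>The resolvent of the \<open>V\<close> corner\<close>
  obtain R0 where R0: "bounded_op F nrm R0"
    and R0d: "\<And>f. f \<in> F \<Longrightarrow> R0 (fscale lam f - d f) = f"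
    and dR0: "\<And>f. f \<in> F \<Longrightarrow> fscale lam (R0 f) - d (R0 f) = f"
    using assms(9) by (auto simp: resolvent_set_def oscale_def d_def)
  note mem = bounded_op_mem[OF pq(1)] bounded_op_mem[OF pq(2)] bounded_op_mem[OF bop(1)]
    bounded_op_mem[OF bop(2)] bounded_op_mem[OF bop(3)] bounded_op_mem[OF bop(4)]
    bounded_op_mem[OF R0] scale_mem add_mem diff_mem uminus_mem
  note add = bounded_op_add[OF bop(1)] bounded_op_add[OF bop(2)] bounded_op_add[OF bop(3)]
    bounded_op_add[OF bop(4)] bounded_op_add[OF R0]
  note diff = bounded_op_diff[OF bop(1)] bounded_op_diff[OF bop(2)] bounded_op_diff[OF bop(3)]
    bounded_op_diff[OF bop(4)] bounded_op_diff[OF R0]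
  note neg = bounded_op_uminus[OF bop(1)] bounded_op_uminus[OF bop(2)] bounded_op_uminus[OF bop(3)]
    bounded_op_uminus[OF bop(4)] bounded_op_uminus[OF R0]
  note scl = bounded_op_scale[OF bop(1)] bounded_op_scale[OF bop(2)] bounded_op_scale[OF bop(3)]
    bounded_op_scale[OF bop(4)] bounded_op_scale[OF R0]
  note calc = mem add diff neg scl lin_pq corner
  have zero: "a 0 = 0" "b 0 = 0" "c 0 = 0" "d 0 = 0" "R0 0 = 0"
    using bop R0 by (auto intro: bounded_op_zero)
  \<comment> \<open>\<open>q\<close> commutes with \<open>lam I - d\<close>, hence with its inverse:
    apply \<open>q\<close> to the resolvent equation, then \<open>R0\<close>.\<close>
  have qR0: "q (R0 f) = R0 (q f)" if f: "f \<in> F" for f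
  proof -
    have "q f = fscale lam (q (R0 f)) - d (q (R0 f))"
      using arg_cong[OF dR0[OF f], of q] by (simp add: lin_pq corner)
    then show ?thesis using R0d[of "q (R0 f)"] f by (simp add: mem)
  qed
  have pR0q: "p (R0 (q f)) = 0" if "f \<in> F" for f
    using qR0[OF that] lin_pq(13) by metis
  have R0c: "q (R0 (c f)) = R0 (c f)" "p (R0 (c f)) = 0" if "f \<in> F" for f
    using qR0[of "c f"] pR0q[of "c f"] that by (simp_all add: mem corner)
  \<comment> \<open>These two forms of the resolvent equation serve as rewrite rules that remove
    every product of \<open>d\<close> and \<open>R0\<close>.\<close>
  have dR0': "d (R0 f) = fscale lam (R0 f) - f" if "f \<in> F" for f
    using dR0[OF that] by (simp add: algebra_simps)
  have R0d': "R0 (d f) = fscale lam (R0 f) - f" if "f \<in> F" for f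
    using R0d[OF that] that by (simp add: calc algebra_simps)
  have inj: "inj_on (lam *\<^sub>o id - d) F"
    by (rule inj_on_inverseI[of _ R0]) (simp add: oscale_def R0d)
  \<comment> \<open>The operator \<open>d - lam I\<close> is the negative of
    \<open>lam I - d\<close>, so its left inverse is \<open>R0\<close> after a sign change.\<close>
  have inj': "inj_on (d - lam *\<^sub>o id) F"
    by (rule inj_on_inverseI[of _ "R0 \<circ> uminus"]) (simp add: oscale_def R0d)
  have R0_eq: "inv_into F (lam *\<^sub>o id - d) f = R0 f" if "f \<in> F" for f
    by (rule inv_into_f_eq[OF inj]) (use that in \<open>simp_all add: mem oscale_def dR0\<close>)
  \<comment> \<open>The factorization uses the inverse of \<open>d - lam I\<close>, the Schur
    operator that of \<open>lam I - d\<close>; this is the sign between them.\<close>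
  have R_eq: "R f = - R0 f" if "f \<in> F" for f
    unfolding assms(11) d_def[symmetric]
    by (rule inv_into_f_eq[OF inj']) (use that in \<open>simp_all add: calc oscale_def dR0'\<close>)
  have L_eq: "L f = a f + b (R0 (c f))" if "f \<in> F" for f
    using that by (simp add: L_def schur_op_def abcd[symmetric] R0_eq mem)
  have L: "bounded_op F nrm L"
  proof -
    have "bounded_op F nrm (a + (b \<circ> R0 \<circ> c))" using bop R0 by auto
    then show ?thesis
      using L_eq by (simp add: bounded_op_def add_mem scale_mem)
  qed
  have compr_eq: "compr S A U U T f = p (T (p f))" "compr S A U V T f = p (T (q f))"
    "compr S A V U T f = q (T (p f))" "compr S A V V T f = q (T (q f))" for T f
    by (simp_all add: compr_def p_def q_def)
  have block_eq: "block_op S A U V T11 T12 T21 T22 f =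
      p (T11 (p f)) + p (T12 (q f)) + q (T21 (p f)) + q (T22 (q f))" for T11 T12 T21 T22 f
    by (simp add: block_op_def compr_eq)
  \<comment> \<open>Each entry already lives on its block, so the second compression done by
    \<open>block_op\<close> changes nothing.\<close>
  have Me_eq: "M_eta f = a f + fscale k (b f) + c f + fscale k (d f)" for f
    by (simp add: assms(12) block_eq abcd[symmetric] k_def[symmetric] oscale_def lin_pq corner)
  have Me: "bounded_op F nrm M_eta"
  proof -
    have "M_eta = a + k *\<^sub>o b + c + k *\<^sub>o d" by (simp add: Me_eq fun_eq_iff oscale_def)
    then show ?thesis using bop by auto
  qed
  define w where "w = chi S A W"
  have w_eq: "w f = p f + q f" for f
    using chi_Un[OF disj] by (simp add: w_def assms(10) p_def q_def)
  have w: "bounded_op F nrm w"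
  proof -
    have "w = p + q" by (simp add: w_eq fun_eq_iff)
    then show ?thesis using pq by auto
  qed

  \<comment> \<open>Equivalence of the resolvent conditions\<close>
  define E where "E = (1 / lam) *\<^sub>o (lam *\<^sub>o id - d)"
  have k: "k * lam = \<eta>" "k \<noteq> 0" using lam eta by (auto simp: k_def)

  \<comment> \<open>\<open>E\<close> is \<open>I - d / lam\<close>, a nonzero multiple of the
    operator whose invertibility is the assumption on \<open>lam\<close>.\<close>
  have E: "bounded_op F nrm E" "invertible_op F nrm E"
    unfolding E_def using bop lam assms(9)
    by (auto intro!: invertible_op_oscale simp: resolvent_set_iff d_def)
  define N1 where "N1 = id + (-1) *\<^sub>o (b \<circ> R0)"
  define N3 where "N3 = id + (- 1 / k) *\<^sub>o (R0 \<circ> c)"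
  \<comment> \<open>\<open>b\<close> sees only the \<open>V\<close> component, and \<open>R0\<close>
    commutes with \<open>q\<close>. As \<open>q\<close> kills the range of \<open>b\<close>, this
    makes \<open>b \<circ> R0\<close> square to zero.\<close>
  have bR0_0: "b (R0 f) = 0" if "f \<in> F" "q f = 0" for f
    using qR0[OF that(1)] that(2) corner(6)[of "R0 f"] by (simp add: zero)
  have N1_eq: "N1 f = f - b (R0 f)" for f
    by (simp add: N1_def oscale_def fscale_minus_one)
  have N3_eq: "N3 f = f - fscale (1 / k) (R0 (c f))" for f
    by (auto simp: N3_def oscale_def fscale_def fun_eq_iff)
  have N1: "bounded_op F nrm N1" "invertible_op F nrm N1"
  proof -
    have T: "bounded_op F nrm ((-1) *\<^sub>o (b \<circ> R0))" using bop R0 by blast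
    show "bounded_op F nrm N1" unfolding N1_def using T by blast
    show "invertible_op F nrm N1"
      unfolding N1_def using T
      by (rule invertible_op_unipotent) (simp add: oscale_def calc bR0_0)
  qed
  \<comment> \<open>\<open>R0 (c f)\<close> lies in the \<open>V\<close> component, which
    \<open>c\<close> and \<open>a\<close> annihilate; thus \<open>R0 \<circ> c\<close> also squares
    to zero.\<close>
  have cR0c: "c (R0 (c f)) = 0" if "f \<in> F" for f
    using R0c[OF that] corner(10)[of "R0 (c f)"] by (simp add: zero)
  have aR0c: "a (R0 (c f)) = 0" if "f \<in> F" for f
    using R0c[OF that] corner(2)[of "R0 (c f)"] by (simp add: zero)
  have N3: "bounded_op F nrm N3" "invertible_op F nrm N3"
  proof -
    have T: "bounded_op F nrm ((- 1 / k) *\<^sub>o (R0 \<circ> c))" using bop R0 by blast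
    show "bounded_op F nrm N3" unfolding N3_def using T by blast
    show "invertible_op F nrm N3"
      unfolding N3_def using T
      by (rule invertible_op_unipotent) (simp add: oscale_def calc cR0c zero)
  qed

  have eta_eq: "\<eta> = k * lam" using k by simp
  define D where "D f = fscale \<eta> f - L f - fscale k (d f)" for f
  have factor: "(\<eta> *\<^sub>o id - M_eta) f = N1 (D (N3 f))" if f: "f \<in> F" for f
  proof -
    \<comment> \<open>\<open>L\<close> vanishes on \<open>R0 (c f)\<close>. The
      \<open>R0 (c f)\<close> terms from \<open>fscale \<eta>\<close> and from \<open>d\<close>
      cancel since \<eta> = \<open>k * lam\<close>, and what is left is the lower left block
      \<open>- c f\<close>.\<close>
    have DN3: "D (N3 f) = fscale \<eta> f - a f - b (R0 (c f)) - fscale k (d f) - c f"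
      using f k(2)
      by (simp add: D_def N3_eq L_eq calc dR0' aR0c cR0c zero eta_eq algebra_simps)
    \<comment> \<open>Only the \<open>V\<close> component contributes: the \<open>a\<close> and
      \<open>b\<close> terms drop out, and \<open>R0d'\<close> cancels the multiples of
      \<open>b (R0 f)\<close>.\<close>
    have "b (R0 (D (N3 f))) = fscale k (b f) - b (R0 (c f))"
      using f by (simp add: DN3 calc bR0_0 R0d' eta_eq algebra_simps)
    then have "N1 (D (N3 f)) = D (N3 f) - (fscale k (b f) - b (R0 (c f)))"
      by (simp only: N1_eq)
    then show ?thesis by (simp add: DN3 Me_eq oscale_def algebra_simps)
  qed
  \<comment> \<open>The cross term \<open>L (d f)\<close> is zero because \<open>a\<close> and
    \<open>c\<close> annihilate the \<open>V\<close> component, so the product expands to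
    \<open>D f\<close>.\<close>
  have D_eq: "D f = ((\<eta> *\<^sub>o id - L) \<circ> E) f" if "f \<in> F" for f
  proof -
    have "a (d f) = 0" "c (d f) = 0"
      using corner(2)[of "d f"] corner(10)[of "d f"] by (simp_all add: corner(15) zero)
    then have "L (d f) = 0" using that by (simp add: L_eq mem zero)
    then show ?thesis using that lam
      by (simp add: D_def E_def oscale_def calc bounded_op_diff[OF L] bounded_op_scale[OF L] k_def
          algebra_simps)
  qed
  have N3_mem: "N3 f \<in> F" if "f \<in> F" for f using N3(1) that by (rule bounded_op_mem)
  have "invertible_op F nrm (\<eta> *\<^sub>o id - M_eta) \<longleftrightarrow>
      invertible_op F nrm (N1 \<circ> (\<eta> *\<^sub>o id - L) \<circ> (E \<circ> N3))"
    by (rule invertible_op_cong) (simp only: factor D_eq N3_mem comp_apply)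
  also have "\<dots> \<longleftrightarrow> invertible_op F nrm (\<eta> *\<^sub>o id - L)"
    using N1 N3 E L by (intro invertible_op_sandwich) (auto intro: invertible_op_comp)
  finally have equiv: "\<eta> \<in> resolvent_set F nrm M_eta \<longleftrightarrow> \<eta> \<in> resolvent_set F nrm L"
    by (simp add: resolvent_set_iff)
  \<comment> \<open>\<open>M_eta\<close> is supported on the range of the projection
    \<open>w\<close>, and \<eta> is nonzero, so passing from \<open>F\<close> to that range is a
    case of \<open>resolvent_set_corner\<close>.\<close>
  have "w (w f) = w f" "w (M_eta f) = M_eta f" "M_eta (w f) = M_eta f" if "f \<in> F" for f
    using that by (simp_all add: w_eq Me_eq calc zero)
  then have corner_equiv:
    "\<eta> \<in> resolvent_set (w ` F) nrm M_eta \<longleftrightarrow> \<eta> \<in> resolvent_set F nrm M_eta"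
    using w Me eta by (intro resolvent_set_corner) auto

  \<comment> \<open>The block factorization on the range of \<open>w\<close>\<close>
  have "(M_eta - \<eta> *\<^sub>o id) f =
        (block_op S A U V id (b \<circ> R) 0 id
         \<circ> block_op S A U V (L - \<eta> *\<^sub>o id) 0 0 (k *\<^sub>o (d - lam *\<^sub>o id))
         \<circ> block_op S A U V id 0 ((lam / \<eta>) *\<^sub>o (R \<circ> c)) id) f"
    if fw: "f \<in> w ` F" for f
  proof -
    \<comment> \<open>On this range \<open>p f + q f = f\<close>, so the diagonal block identities
      add up to the full identity; this lets the outer block factors be replaced by
      \<open>N1\<close> and \<open>N3\<close>.\<close>
    obtain g where "g \<in> F" "f = p g + q g" using fw by (auto simp: w_eq)
    then have f: "f \<in> F" "p f + q f = f" by (simp_all add: mem lin_pq)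
    have third: "block_op S A U V id 0 ((lam / \<eta>) *\<^sub>o (R \<circ> c)) id f = N3 f"
    proof -
      have "lam / \<eta> = 1 / k" using lam eta by (simp add: k_def)
      then show ?thesis using f
        by (simp add: block_eq N3_eq oscale_def calc R_eq R0c algebra_simps)
    qed
    \<comment> \<open>The middle block factor carries the opposite sign to \<open>D\<close>, as the
      statement subtracts \<eta> from the operator.\<close>
    have second: "block_op S A U V (L - \<eta> *\<^sub>o id) 0 0 (k *\<^sub>o (d - lam *\<^sub>o id)) g = - D g"
      if g: "g \<in> F" "p g + q g = g" for g
    proof -
      have "fscale \<eta> (p g) + fscale \<eta> (q g) = fscale \<eta> g"
        using arg_cong[OF g(2), of "fscale \<eta>"] by simp
      then show ?thesis using g
        by (simp add: block_eq D_def oscale_def L_eq calc k(1) algebra_simps)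
    qed
    have first: "block_op S A U V id (b \<circ> R) 0 id g = N1 g"
      if g: "g \<in> F" "p g + q g = g" for g
    proof -
      have "b (R0 (q g)) = b (R0 g)" using g corner(6)[of "R0 g"] by (simp add: qR0)
      then show ?thesis using g
        by (simp add: block_eq N1_eq calc R_eq algebra_simps)
    qed
    \<comment> \<open>The replacements for the block factors are valid only on the range of
      \<open>w\<close>, so each intermediate value must be shown to stay there.\<close>
    have N3f: "N3 f \<in> F" "p (N3 f) + q (N3 f) = N3 f"
      using f N3_mem by (simp_all add: N3_eq lin_pq R0c algebra_simps)
    have DN3f: "D (N3 f) \<in> F" "p (D (N3 f)) + q (D (N3 f)) = D (N3 f)"
    proof -
      show "D (N3 f) \<in> F" using N3f L by (simp add: D_def calc bounded_op_mem)
      have "fscale \<eta> (p (N3 f)) + fscale \<eta> (q (N3 f)) = fscale \<eta> (N3 f)"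
        using arg_cong[OF N3f(2), of "fscale \<eta>"] by simp
      then show "p (D (N3 f)) + q (D (N3 f)) = D (N3 f)"
        using N3f(1) by (simp add: D_def L_eq lin_pq corner algebra_simps)
    qed
    have "block_op S A U V id (b \<circ> R) 0 id (- D (N3 f)) = N1 (- D (N3 f))"
    proof (rule first)
      show "- D (N3 f) \<in> F" using DN3f by (simp add: uminus_mem)
      show "p (- D (N3 f)) + q (- D (N3 f)) = - D (N3 f)"
        using arg_cong[OF DN3f(2), of uminus] by (simp add: lin_pq)
    qed
    \<comment> \<open>Linearity of \<open>N1\<close> brings the sign outside, turning
      \<open>factor\<close> for \<eta> \<open>I - M_eta\<close> into the stated identity.\<close>
    also have "\<dots> = - N1 (D (N3 f))" using N1(1) DN3f(1) by (rule bounded_op_uminus)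
    also have "\<dots> = (M_eta - \<eta> *\<^sub>o id) f" using factor[OF f(1), symmetric] by simp
    finally show ?thesis using third second[OF N3f] by simp
  qed
  then show ?thesis
    using equiv corner_equiv unfolding w_def b_def c_def d_def L_def k_def by blast
qed

end
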